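(* Let $k\ge 1$ be an integer and let $0\le i\le k$ be an integer. Then $$\sum_{\substack{0\le m\le \min\{i,k-i\}\\ 1\le n\le k-i}}(-1)^n\,2^{\,n-m}\binom{k+1}{i-m}\binom{k}{i+n}\binom{n-1}{m}=(-1)^{k-i}\binom{k}{i}-\binom{k}{i}^2 .$$
   Context: The sum is over integer pairs $(m,n)$ in the indicated ranges (an empty sum is $0$). $\binom{a}{b}$ is the usual binomial coefficient for non-negative integers, equal to $0$ when $b>a$. *)

theory Defs
  imports Complex_Main
begin

end

theory Submission
  imports Defs "HOL-Computational_Algebra.Polynomial" "HOL-Computational_Algebra.Formal_Power_Series"
begin

unbundle fps_syntax

text \<open>
  The sum over \<open>m\<close> is the coefficient of \<open>x^i\<close> in \<open>2 (1 + x)^(k+1) (2 + x)^(n-1)\<close>. The sum over \<open>n\<close>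
  is then a tail of the binomial expansion of \<open>(1 - (2 + x))^k\<close>, which can be re-expanded in powers of
  \<open>1 - (2 + x) = - (1 + x)\<close>. Thus the left-hand side equals
  \<open>2 (\<Sum>l<k. (-1)^(k-l) (l choose i) (2k-l choose i))\<close>. This is a symmetric convolution without its
  middle term \<open>(k choose i)^2\<close>, and the full convolution is the coefficient of \<open>x^(2k)\<close> in
  \<open>(-1)^i x^(2i) / (1 - x^2)^(i+1)\<close>.
\<close>

text \<open>By Pascal's rule, both sides satisfy
  \<open>S (k + 1) = (1 + z) * S k + (k choose i)\<close> and vanish at
  \<open>k = 0\<close>.\<close>

lemma binomial_tail_re_expansion:
  fixes z :: "'a :: comm_ring_1"
  shows "(\<Sum>p<k. of_nat (k choose (Suc i + p)) * z ^ p)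
           = (\<Sum>l<k. of_nat (l choose i) * (1 + z) ^ (k - 1 - l))"
proof (induction k)
  case 0
  show ?case by simp
next
  case (Suc k)
  let ?F = "\<Sum>p<k. of_nat (k choose (Suc i + p)) * z ^ p"
  have "(\<Sum>p<Suc k. of_nat (Suc k choose (Suc i + p)) * z ^ p)
          = (\<Sum>p<Suc k. of_nat (k choose (i + p)) * z ^ p)
            + (\<Sum>p<Suc k. of_nat (k choose (Suc i + p)) * z ^ p)"
    by (simp add: sum.distrib algebra_simps flip: sum.distrib)
  also have "(\<Sum>p<Suc k. of_nat (k choose (i + p)) * z ^ p) = of_nat (k choose i) + z * ?F"
    by (subst sum.lessThan_Suc_shift) (simp add: sum_distrib_left algebra_simps)
  also have "(\<Sum>p<Suc k. of_nat (k choose (Suc i + p)) * z ^ p) = ?F"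
    by (simp add: binomial_eq_0)
  also have "of_nat (k choose i) + z * ?F + ?F = (1 + z) * ?F + of_nat (k choose i)"
    by (simp add: algebra_simps)
  also have "(1 + z) * ?F = (\<Sum>l<k. of_nat (l choose i) * (1 + z) ^ (k - l))"
    unfolding Suc.IH sum_distrib_left
  proof (rule sum.cong[OF refl])
    fix l assume "l \<in> {..<k}"
    then have "k - l = Suc (k - 1 - l)" by auto
    then have "(1 + z) ^ (k - l) = (1 + z) * (1 + z) ^ (k - 1 - l)"
      by (simp only: power_Suc)
    then show "(1 + z) * (of_nat (l choose i) * (1 + z) ^ (k - 1 - l))
                 = of_nat (l choose i) * (1 + z) ^ (k - l)"
      by (simp only: mult.left_commute)
  qed
  finally show ?case by simp
qed

lemma coeff_linear_poly_power_all:
  fixes c :: "'a :: comm_ring_1"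
  shows "coeff ([:c, 1:] ^ n) j = of_nat (n choose j) * c ^ (n - j)"
proof (cases "j \<le> n")
  case True
  then show ?thesis by (simp add: coeff_linear_poly_power)
next
  case False
  have "degree ([:c, 1:] ^ n) \<le> n"
    by (rule order.trans[OF degree_power_le]) simp
  with False show ?thesis by (simp add: coeff_eq_0 binomial_eq_0)
qed

text \<open>This is the series of \<open>(c x)^i / (1 - c x)^(i+1)\<close>. The next two lemmas
  express that closed form as a recurrence in \<open>i\<close>, free of division.\<close>

definition binomial_fps :: "nat \<Rightarrow> real \<Rightarrow> real fps" where
  "binomial_fps i c = Abs_fps (\<lambda>l. c ^ l * real (l choose i))"

lemma binomial_fps_0: "(1 - fps_const c * fps_X) * binomial_fps 0 c = 1"
proof (rule fps_ext)
  fix n show "((1 - fps_const c * fps_X) * binomial_fps 0 c) $ n = 1 $ n"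
    by (cases n) (simp_all add: binomial_fps_def algebra_simps)
qed

lemma binomial_fps_Suc:
  "(1 - fps_const c * fps_X) * binomial_fps (Suc i) c = fps_const c * fps_X * binomial_fps i c"
proof (rule fps_ext)
  fix n
  show "((1 - fps_const c * fps_X) * binomial_fps (Suc i) c) $ n
          = (fps_const c * fps_X * binomial_fps i c) $ n"
    by (cases n) (simp_all add: binomial_fps_def algebra_simps)
qed

text \<open>The closed forms multiply to \<open>(-1)^i x^(2i) / (1 - x^2)^(i+1)\<close>, a series in
  \<open>x^2\<close>.\<close>

lemma binomial_fps_mult:
  "binomial_fps i (- 1) * binomial_fps i 1
     = Abs_fps (\<lambda>n. if even n then (- 1) ^ i * real (n div 2 choose i) else 0)"
proof -
  let ?Q = "\<lambda>i. Abs_fps (\<lambda>n. if even n then (- 1) ^ i * real (n div 2 choose i) else 0)"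
  let ?X = "fps_X :: real fps"
  have factor: "(1 - ?X ^ 2) = (1 - fps_const (- 1) * ?X) * (1 - fps_const 1 * ?X)"
    by (simp add: algebra_simps power2_eq_square flip: fps_const_neg)
  have ne: "1 - ?X ^ 2 \<noteq> 0"
  proof
    assume "1 - ?X ^ 2 = 0"
    then have "(1 - ?X ^ 2) $ 0 = 0" by simp
    then show False by simp
  qed
  \<comment> \<open>The factor \<open>1 - ?X ^ 2\<close> splits into the two linear factors that the
    recurrences absorb, one for each series. It is nonzero, so it can be cancelled in the induction
    hypothesis and at the end.\<close>
  have "(1 - ?X ^ 2) * (binomial_fps i (- 1) * binomial_fps i 1) = (1 - ?X ^ 2) * ?Q i"
  proof (induction i)
    case 0
    have "(1 - ?X ^ 2) * ?Q 0 = 1"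
    proof (rule fps_ext)
      fix n show "((1 - ?X ^ 2) * ?Q 0) $ n = 1 $ n"
        by (auto simp: algebra_simps fps_X_power_mult_nth)
    qed
    moreover have "(1 - ?X ^ 2) * (binomial_fps 0 (- 1) * binomial_fps 0 1)
        = ((1 - fps_const (- 1) * ?X) * binomial_fps 0 (- 1))
          * ((1 - fps_const 1 * ?X) * binomial_fps 0 1)"
      unfolding factor by (simp only: ac_simps)
    ultimately show ?case by (simp only: binomial_fps_0 mult_1)
  next
    case (Suc i)
    have IH: "binomial_fps i (- 1) * binomial_fps i 1 = ?Q i"
      using Suc.IH ne by (simp only: mult_cancel_left) simp
    have "(1 - ?X ^ 2) * (binomial_fps (Suc i) (- 1) * binomial_fps (Suc i) 1)
        = ((1 - fps_const (- 1) * ?X) * binomial_fps (Suc i) (- 1))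
          * ((1 - fps_const 1 * ?X) * binomial_fps (Suc i) 1)"
      unfolding factor by (simp only: ac_simps)
    also have "\<dots> = (fps_const (- 1) * ?X * (fps_const 1 * ?X))
                        * (binomial_fps i (- 1) * binomial_fps i 1)"
      unfolding binomial_fps_Suc by (simp only: ac_simps)
    also have "\<dots> = - (?X ^ 2 * ?Q i)"
      unfolding IH by (simp add: power2_eq_square flip: fps_const_neg)
    also have "\<dots> = (1 - ?X ^ 2) * ?Q (Suc i)"
    proof (rule fps_ext)
      fix n
      \<comment> \<open>Multiplying by \<open>?X ^ 2\<close> keeps the parity of the index and
        lowers \<open>n div 2\<close> by one, so the last case is Pascal's rule.\<close>
      consider "n = 0" | "n = 1" | l where "n = Suc (Suc l)"
        by (metis One_nat_def not0_implies_Suc)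
      then show "(- (?X ^ 2 * ?Q i)) $ n = ((1 - ?X ^ 2) * ?Q (Suc i)) $ n"
        by cases (simp_all add: left_diff_distrib fps_X_power_mult_nth algebra_simps)
    qed
    finally show ?case .
  qed
  with ne show ?thesis by simp
qed

lemma alternating_binomial_convolution:
  "(\<Sum>l\<le>2 * k. (- 1) ^ l * real (l choose i) * real ((2 * k - l) choose i))
     = (- 1) ^ i * real (k choose i)"
proof -
  have "(binomial_fps i (- 1) * binomial_fps i 1) $ (2 * k) = (- 1) ^ i * real (k choose i)"
    unfolding binomial_fps_mult by simp
  then show ?thesis
    by (simp add: fps_mult_nth binomial_fps_def atMost_atLeast0)
qed

lemma alternating_binomial_half_convolution:
  assumes "i \<le> k"
  shows "2 * (\<Sum>l<k. (- 1) ^ (k - l) * real (l choose i) * real ((2 * k - l) choose i))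
           = (- 1) ^ (k - i) * real (k choose i) - (real (k choose i))\<^sup>2"
proof -
  define f where "f l = (- 1) ^ l * real (l choose i) * real ((2 * k - l) choose i)" for l
  have "{..2 * k} = {..<k} \<union> ({k} \<union> {k<..2 * k})" by auto
  moreover have "sum f ({..<k} \<union> ({k} \<union> {k<..2 * k})) = sum f {..<k} + (f k + sum f {k<..2 * k})"
    by (subst sum.union_disjoint; auto)
  ultimately have "sum f {..2 * k} = sum f {..<k} + (f k + sum f {k<..2 * k})"
    by simp
  \<comment> \<open>The reflection of \<open>l\<close> to \<open>2 * k - l\<close> swaps the two
    binomials and preserves the sign, since \<open>2 * k\<close> is even.\<close>
  also have "sum f {k<..2 * k} = sum f {..<k}"
    by (rule sum.reindex_bij_witness[where i = "\<lambda>l. 2 * k - l" and j = "\<lambda>l. 2 * k - l"])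
       (auto simp: f_def minus_one_power_iff)
  finally have "2 * sum f {..<k} = (- 1) ^ i * real (k choose i) - (- 1) ^ k * (real (k choose i))\<^sup>2"
    using alternating_binomial_convolution[where k = k and i = i]
    by (simp add: f_def power2_eq_square)
  \<comment> \<open>Multiplying by \<open>(- 1) ^ k\<close> turns the sign \<open>(- 1) ^ l\<close>
    into \<open>(- 1) ^ (k - l)\<close> and clears the sign of the square.\<close>
  then have "2 * ((- 1) ^ k * sum f {..<k})
      = (- 1) ^ k * (- 1) ^ i * real (k choose i) - (- 1) ^ k * (- 1) ^ k * (real (k choose i))\<^sup>2"
    by (cases "even k") simp_all
  moreover have "(- 1) ^ k * (- 1) ^ i = (- 1 :: real) ^ (k - i)"
    using assms by (simp add: minus_one_power_iff)
  moreover have "(- 1) ^ k * sum f {..<k}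
      = (\<Sum>l<k. (- 1) ^ (k - l) * real (l choose i) * real ((2 * k - l) choose i))"
    unfolding sum_distrib_left f_def
    by (rule sum.cong) (auto simp: minus_one_power_iff)
  ultimately show ?thesis by (simp flip: power_add mult_2)
qed

text \<open>This is the Cauchy product of two binomial expansions. The exponent of 2 exceeds the
  \<open>p - m\<close> of the expansion by one, whence the factor 2.\<close>

lemma inner_sum_eq_coeff:
  assumes "p < d"
  shows "(\<Sum>m = 0..min i d. 2 powi (int (Suc p) - int m)
            * real (N choose (i - m)) * real (p choose m))
           = 2 * coeff ([:2, 1:] ^ p * [:1, 1:] ^ N :: real poly) i"
proof -
  \<comment> \<open>The added indices satisfy \<open>m > d > p\<close>, so \<open>p choose m\<close>
    vanishes there.\<close>
  have "(\<Sum>m = 0..min i d. 2 powi (int (Suc p) - int m) * real (N choose (i - m)) * real (p choose m))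
      = (\<Sum>m\<le>i. 2 powi (int (Suc p) - int m) * real (N choose (i - m)) * real (p choose m))"
    by (rule sum.mono_neutral_left) (use assms in \<open>auto simp: binomial_eq_0\<close>)
  also have "\<dots> = (\<Sum>m\<le>i. 2 * (coeff ([:2, 1:] ^ p) m * coeff ([:1, 1:] ^ N) (i - m)))"
  proof (rule sum.cong[OF refl])
    fix m
    show "2 powi (int (Suc p) - int m) * real (N choose (i - m)) * real (p choose m)
        = 2 * (coeff ([:2, 1:] ^ p) m * coeff ([:1, 1:] ^ N) (i - m))"
    proof (cases "m \<le> p")
      case True
      then have "int (Suc p) - int m = int (Suc (p - m))" by simp
      then have "(2::real) powi (int (Suc p) - int m) = 2 * 2 ^ (p - m)"
        by (simp only: power_int_of_nat power_Suc)
      then show ?thesis by (simp add: coeff_linear_poly_power_all)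
    next
      case False
      then show ?thesis by (simp add: coeff_linear_poly_power_all binomial_eq_0)
    qed
  qed
  also have "\<dots> = 2 * coeff ([:2, 1:] ^ p * [:1, 1:] ^ N) i"
    by (simp add: coeff_mult sum_distrib_left)
  finally show ?thesis .
qed

theorem theorem2p5:
  fixes k i :: nat
  assumes "k \<ge> 1" and "i \<le> k"
  shows "(\<Sum>(m, n) \<in> {0..min i (k - i)} \<times> {1..k - i}.
            (-1) ^ n * 2 powi (int n - int m)
              * real ((k + 1) choose (i - m)) * real (k choose (i + n)) * real ((n - 1) choose m))
         = (-1) ^ (k - i) * real (k choose i) - (real (k choose i))\<^sup>2"
    (is "?lhs = _")
proof -
  let ?A = "[:2, 1:] :: real poly" and ?B = "[:1, 1:] :: real poly"
  have pow_neg: "(- P) ^ n = smult ((- 1) ^ n) (P ^ n)" for P :: "real poly" and n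
    by (simp add: minus_one_power_iff)
  have "?lhs = (\<Sum>n = 1..k - i. \<Sum>m = 0..min i (k - i).
          (-1) ^ n * 2 powi (int n - int m)
            * real ((k + 1) choose (i - m)) * real (k choose (i + n)) * real ((n - 1) choose m))"
    by (subst sum.swap) (simp add: sum.cartesian_product)
  also have "\<dots> = (\<Sum>p<k - i. \<Sum>m = 0..min i (k - i).
          (-1) ^ Suc p * 2 powi (int (Suc p) - int m)
            * real ((k + 1) choose (i - m)) * real (k choose (Suc i + p)) * real (p choose m))"
    by (rule sum.reindex_bij_witness[where i = Suc and j = "\<lambda>n. n - 1"]) auto
  also have "\<dots> = (\<Sum>p<k - i. (-1) ^ Suc p * real (k choose (Suc i + p)) *
      (\<Sum>m = 0..min i (k - i). 2 powi (int (Suc p) - int m)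
            * real ((k + 1) choose (i - m)) * real (p choose m)))"
    unfolding sum_distrib_left by (intro sum.cong refl) (simp only: ac_simps)
  also have "\<dots> = (\<Sum>p<k - i. (-1) ^ Suc p * real (k choose (Suc i + p)) *
      (2 * coeff (?A ^ p * ?B ^ (k + 1)) i))"
    by (intro sum.cong refl arg_cong2[where f = "(*)"] inner_sum_eq_coeff) auto
  \<comment> \<open>For \<open>p \<ge> k - i\<close> the lower index \<open>Suc i + p\<close>
    exceeds \<open>k\<close>. The longer range is the one in
    \<open>binomial_tail_re_expansion\<close>.\<close>
  also have "\<dots> = (\<Sum>p<k. (-1) ^ Suc p * real (k choose (Suc i + p)) *
      (2 * coeff (?A ^ p * ?B ^ (k + 1)) i))"
    by (rule sum.mono_neutral_left) (auto simp: binomial_eq_0)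
  also have "\<dots> = - 2 * coeff ((\<Sum>p<k. of_nat (k choose (Suc i + p)) * (- ?A) ^ p) * ?B ^ (k + 1)) i"
    unfolding sum_distrib_right coeff_sum sum_distrib_left pow_neg of_nat_poly
    by (intro sum.cong refl) simp
  \<comment> \<open>With \<open>z = - ?A\<close> one has \<open>1 + z = - ?B\<close>, so only powers
    of \<open>1 + x\<close> remain.\<close>
  also have "(\<Sum>p<k. of_nat (k choose (Suc i + p)) * (- ?A) ^ p)
      = (\<Sum>l<k. of_nat (l choose i) * (- ?B) ^ (k - 1 - l))"
    unfolding binomial_tail_re_expansion by (simp add: one_pCons)
  also have "- 2 * coeff (\<dots> * ?B ^ (k + 1)) i
      = (\<Sum>l<k. 2 * ((- 1) ^ (k - l) * real (l choose i) * real ((2 * k - l) choose i)))"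
    unfolding sum_distrib_right coeff_sum sum_distrib_left
  proof (rule sum.cong[OF refl])
    fix l assume "l \<in> {..<k}"
    \<comment> \<open>The powers of \<open>?B\<close> merge to exponent \<open>2 * k - l\<close>;
      the leading minus sign raises the sign exponent from \<open>k - 1 - l\<close> to
      \<open>k - l\<close>.\<close>
    then have exps: "k - 1 - l + (k + 1) = 2 * k - l" and sgn: "k - l = Suc (k - 1 - l)" by auto
    have "of_nat (l choose i) * (- ?B) ^ (k - 1 - l) * ?B ^ (k + 1)
        = smult (real (l choose i) * (- 1) ^ (k - 1 - l)) (?B ^ (2 * k - l))"
      unfolding pow_neg of_nat_poly exps[symmetric] power_add by (simp add: mult.commute)
    then show "- 2 * coeff (of_nat (l choose i) * (- ?B) ^ (k - 1 - l) * ?B ^ (k + 1)) i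
        = 2 * ((- 1) ^ (k - l) * real (l choose i) * real ((2 * k - l) choose i))"
      unfolding sgn by (simp add: coeff_linear_poly_power_all)
  qed
  also have "\<dots> = (-1) ^ (k - i) * real (k choose i) - (real (k choose i))\<^sup>2"
    using alternating_binomial_half_convolution[OF assms(2)] by (simp add: sum_distrib_left)
  finally show ?thesis .
qed

end
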